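(* Let $d\ge1$ be an integer, let $q\in(\tfrac12,1)$, let $0<\delta<\tfrac12$, and put $\delta'=\delta\,q^{-(d-1)}$. If $\delta'<\tfrac12$, then for every $c>0$ $$\Lambda_\delta(c;d)\ \ge\ d\,N_q(c)^{\,d-1}\,D(\delta',c),$$ where for $d=1$ the convention $N_q(c)^0=1$ is used.
   Context: For $c>0$, $S_c$ is the positive trace-class integral operator on $L^2(0,c)$ with kernel $\frac{\sin(\pi(x-y))}{\pi(x-y)}$ (equal to $1$ for $x=y$); its eigenvalues are simple, $1>\lambda_0(c)>\lambda_1(c)>\cdots>0$. For $0<a<1$, $N_a(c)=\#\{n:\lambda_n(c)>a\}$, and for $0<\delta<\tfrac12$, $D(\delta,c)=\#\{n:\delta<\lambda_n(c)\le\tfrac12\}$. For a multi-index $\mathbf n=(n_1,\dots,n_d)$ of nonnegative integers put $\mu_{\mathbf n}=\prod_{r=1}^d\lambda_{n_r}(c)$; these are the positive eigenvalues, with multiplicity, of the concentration operator $P_AQ_BP_A$ of the cube pair $A=(0,c)^d$ (space side), $B=(-\tfrac12,\tfrac12)^d$ (frequency side). Define $\Lambda_\delta(c;d)=\#\{\mathbf n:\delta<\mu_{\mathbf n}\le1-\delta\}$, counting multi-indices. *)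

theory Defs
  imports "HOL-Analysis.Analysis"
begin

definition sinc_kernel :: "real \<Rightarrow> real \<Rightarrow> real" where
  "sinc_kernel x y = (if x = y then 1 else sin (pi * (x - y)) / (pi * (x - y)))"

definition interval_measure_on :: "real \<Rightarrow> real measure" where
  "interval_measure_on c = restrict_space lborel {0<..<c}"

(* Elements of L^2(0,c) are represented by functions, identified when they agree almost everywhere. *)
definition square_integrable_fns :: "real \<Rightarrow> (real \<Rightarrow> complex) set" where
  "square_integrable_fns c =
     {f. f \<in> borel_measurable (interval_measure_on c) \<and>
         integrable (interval_measure_on c) (\<lambda>x. (cmod (f x))\<^sup>2)}"

definition S_op :: "real \<Rightarrow> (real \<Rightarrow> complex) \<Rightarrow> real \<Rightarrow> complex" where
  "S_op c f x = (LINT y|interval_measure_on c. complex_of_real (sinc_kernel x y) * f y)"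

(* S_c is self-adjoint, so only real numbers can be eigenvalues. *)
definition S_eigenvalues :: "real \<Rightarrow> real set" where
  "S_eigenvalues c =
     {t. \<exists>f \<in> square_integrable_fns c.
           \<not> (AE x in interval_measure_on c. f x = 0) \<and>
           (AE x in interval_measure_on c. S_op c f x = complex_of_real t * f x)}"

(* The eigenvalues in decreasing order: each one is the largest not listed before. They are
   simple, so each is listed once. As S_c is compact and positive and has infinitely many
   positive eigenvalues, the supremum is attained at one of them; the inserted 0 (the usual
   padding of an eigenvalue sequence) is never selected. *)
fun eigval :: "real \<Rightarrow> nat \<Rightarrow> real" where
  "eigval c n = Sup (insert 0 (S_eigenvalues c - eigval c ` {..<n}))"

declare eigval.simps [simp del]

(* The index sets counted below are finite for positive thresholds, because the eigenvalues
   tend to 0; so card is the true number of elements. *)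

definition N_count :: "real \<Rightarrow> real \<Rightarrow> nat" where
  "N_count a c = card {n. eigval c n > a}"

definition D_count :: "real \<Rightarrow> real \<Rightarrow> nat" where
  "D_count \<delta> c = card {n. \<delta> < eigval c n \<and> eigval c n \<le> 1/2}"

(* A multi-index is a function on {..<d}; components are numbered from 0. *)
definition mu :: "real \<Rightarrow> nat \<Rightarrow> (nat \<Rightarrow> nat) \<Rightarrow> real" where
  "mu c d \<nu> = (\<Prod>r<d. eigval c (\<nu> r))"

definition Lambda_count :: "real \<Rightarrow> real \<Rightarrow> nat \<Rightarrow> nat" where
  "Lambda_count \<delta> c d =
     card {\<nu> \<in> {..<d} \<rightarrow>\<^sub>E (UNIV :: nat set). \<delta> < mu c d \<nu> \<and> mu c d \<nu> \<le> 1 - \<delta>}"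

end

theory Submission
  imports Defs
begin

text \<open>
  If one component of a multi-index has its eigenvalue in \<open>(\<delta>', 1/2]\<close> and the others have eigenvalues
  above \<open>q\<close>, then the product of the eigenvalues exceeds \<open>\<delta>' q\<^sup>d\<^sup>-\<^sup>1 = \<delta>\<close> and is at most
  \<open>1/2\<close>; as \<open>q > 1/2\<close>, the exceptional component is determined by the multi-index. This uses two
  facts about the operator. The eigenvalues above a positive threshold are finite in number:
  Bessel's inequality for the rows of the kernel bounds the sum of their squares by \<open>c\<^sup>2\<close>.
  The eigenvalues are at most 1: for a normalized eigenfunction with Fourier transform \<open>F\<close>,
  the eigenvalue is the integral of \<open>\<bar>F\<bar>\<^sup>2\<close> over \<open>[-1/2, 1/2]\<close>. Instead of Plancherel's theorem,
  cut this interval into \<open>N \<ge> c\<close> equal pieces; for every \<open>s\<close>, Bessel's inequality for the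
  exponentials of period \<open>N\<close> gives \<open>(\<Sum>k<N. \<bar>F (s + k / N)\<bar>\<^sup>2) \<le> N\<close>.
\<close>

section \<open>Square-integrable functions and Bessel's inequality\<close>

lemma borel_measurable_cnj [measurable (raw)]:
  "f \<in> borel_measurable M \<Longrightarrow> (\<lambda>x. cnj (f x)) \<in> borel_measurable M"
  by (rule borel_measurable_continuous_on[OF continuous_on_cnj[OF continuous_on_id]])

lemma L2_mult_integrable:
  fixes f g :: "'a \<Rightarrow> complex"
  assumes [measurable]: "f \<in> borel_measurable M" "g \<in> borel_measurable M"
    and "integrable M (\<lambda>x. (cmod (f x))\<^sup>2)" "integrable M (\<lambda>x. (cmod (g x))\<^sup>2)"
  shows "integrable M (\<lambda>x. f x * g x)"
proof (rule Bochner_Integration.integrable_bound)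
  show "integrable M (\<lambda>x. (cmod (f x))\<^sup>2 + (cmod (g x))\<^sup>2)"
    using assms by simp
  have "a * b \<le> a\<^sup>2 + b\<^sup>2" if "0 \<le> a" "0 \<le> b" for a b :: real
    using sum_squares_bound[of a b] that mult_nonneg_nonneg[OF that] by linarith
  then show "AE x in M. norm (f x * g x) \<le> norm ((cmod (f x))\<^sup>2 + (cmod (g x))\<^sup>2)"
    by (simp add: norm_mult)
qed simp

text \<open>Subtracting the projection of \<open>f\<close> onto the span of the \<open>e i\<close>
  leaves a remainder \<open>h\<close> whose squared norm is the difference of the two sides. The
  inequality is applied to the rows of the sinc kernel and to exponentials.\<close>

lemma Bessel_inequality_L2:
  fixes f :: "'a \<Rightarrow> complex" and e :: "'i \<Rightarrow> 'a \<Rightarrow> complex"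
  assumes I: "finite I"
    and f: "f \<in> borel_measurable M" "integrable M (\<lambda>x. (cmod (f x))\<^sup>2)"
    and e: "\<And>i. i \<in> I \<Longrightarrow> e i \<in> borel_measurable M"
           "\<And>i. i \<in> I \<Longrightarrow> integrable M (\<lambda>x. (cmod (e i x))\<^sup>2)"
    and orth: "\<And>i j. i \<in> I \<Longrightarrow> j \<in> I \<Longrightarrow> (\<integral>x. e i x * cnj (e j x) \<partial>M) = (if i = j then 1 else 0)"
  shows "(\<Sum>i\<in>I. (cmod (\<integral>x. f x * cnj (e i x) \<partial>M))\<^sup>2) \<le> (\<integral>x. (cmod (f x))\<^sup>2 \<partial>M)"
proof -
  define b where "b i = (\<integral>x. f x * cnj (e i x) \<partial>M)" for i
  define h where "h x = f x - (\<Sum>i\<in>I. b i * e i x)" for x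
  \<comment> \<open>Each of the three sums consists of constants times integrable products, so the
    integral can be taken term by term.\<close>
  have expand: "h x * cnj (h x) = f x * cnj (f x) - (\<Sum>i\<in>I. cnj (b i) * (f x * cnj (e i x)))
      - (\<Sum>i\<in>I. b i * cnj (f x * cnj (e i x)))
      + (\<Sum>i\<in>I. \<Sum>j\<in>I. b i * cnj (b j) * (e i x * cnj (e j x)))" for x
  proof -
    define s where "s = (\<Sum>i\<in>I. b i * e i x)"
    have "h x * cnj (h x) = f x * cnj (f x) - f x * cnj s - s * cnj (f x) + s * cnj s"
      by (simp add: h_def s_def algebra_simps)
    moreover have "f x * cnj s = (\<Sum>i\<in>I. cnj (b i) * (f x * cnj (e i x)))"
      by (simp add: s_def sum_distrib_left mult_ac)
    moreover have "s * cnj (f x) = (\<Sum>i\<in>I. b i * cnj (f x * cnj (e i x)))"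
      by (simp add: s_def sum_distrib_left mult_ac)
    moreover have "s * cnj s = (\<Sum>i\<in>I. \<Sum>j\<in>I. b i * cnj (b j) * (e i x * cnj (e j x)))"
      by (simp add: s_def sum_product mult_ac)
    ultimately show ?thesis by simp
  qed
  have ff: "integrable M (\<lambda>x. f x * cnj (f x))"
    using f by (intro L2_mult_integrable borel_measurable_cnj) auto
  have fe: "integrable M (\<lambda>x. f x * cnj (e i x))" if "i \<in> I" for i
    using f e that by (intro L2_mult_integrable borel_measurable_cnj) auto
  have ee: "integrable M (\<lambda>x. e i x * cnj (e j x))" if "i \<in> I" "j \<in> I" for i j
    using e that by (intro L2_mult_integrable borel_measurable_cnj) auto
  have ef: "integrable M (\<lambda>x. cnj (f x * cnj (e i x)))" if "i \<in> I" for i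
    using fe[OF that] by (simp only: integrable_cnj)
  have "(\<integral>x. h x * cnj (h x) \<partial>M) = (\<integral>x. f x * cnj (f x) \<partial>M) - (\<Sum>i\<in>I. cnj (b i) * b i)
      - (\<Sum>i\<in>I. b i * cnj (b i))
      + (\<Sum>i\<in>I. \<Sum>j\<in>I. b i * cnj (b j) * (if i = j then 1 else 0))"
  proof -
    have i1: "integrable M (\<lambda>x. \<Sum>i\<in>I. cnj (b i) * (f x * cnj (e i x)))"
      by (intro Bochner_Integration.integrable_sum integrable_mult_right fe)
    have i2: "integrable M (\<lambda>x. \<Sum>i\<in>I. b i * cnj (f x * cnj (e i x)))"
      by (intro Bochner_Integration.integrable_sum integrable_mult_right ef)
    have i3: "integrable M (\<lambda>x. \<Sum>i\<in>I. \<Sum>j\<in>I. b i * cnj (b j) * (e i x * cnj (e j x)))"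
      by (intro Bochner_Integration.integrable_sum integrable_mult_right ee)
    have j1: "(\<integral>x. (\<Sum>i\<in>I. cnj (b i) * (f x * cnj (e i x))) \<partial>M) = (\<Sum>i\<in>I. cnj (b i) * b i)"
      by (subst Bochner_Integration.integral_sum) (auto intro!: fe sum.cong simp: b_def)
    have j2: "(\<integral>x. (\<Sum>i\<in>I. b i * cnj (f x * cnj (e i x))) \<partial>M) = (\<Sum>i\<in>I. b i * cnj (b i))"
      unfolding b_def
      by (subst Bochner_Integration.integral_sum)
        (use ef in \<open>auto intro!: sum.cong simp: Bochner_Integration.integral_cnj[symmetric] simp del: Bochner_Integration.integral_cnj\<close>)
    have j3: "(\<integral>x. (\<Sum>i\<in>I. \<Sum>j\<in>I. b i * cnj (b j) * (e i x * cnj (e j x))) \<partial>M)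
       = (\<Sum>i\<in>I. \<Sum>j\<in>I. b i * cnj (b j) * (if i = j then 1 else 0))"
    proof -
      have "(\<integral>x. (\<Sum>j\<in>I. b i * cnj (b j) * (e i x * cnj (e j x))) \<partial>M)
          = (\<Sum>j\<in>I. b i * cnj (b j) * (if i = j then 1 else 0))" if "i \<in> I" for i
        using that by (subst Bochner_Integration.integral_sum) (simp_all add: ee orth)
      then show ?thesis
        by (subst Bochner_Integration.integral_sum) (simp_all add: ee)
    qed
    show ?thesis
      unfolding expand using ff i1 i2 i3 j1 j2 j3
      by (simp only: Bochner_Integration.integral_add Bochner_Integration.integral_diff
          Bochner_Integration.integrable_add Bochner_Integration.integrable_diff)
  qed
  \<comment> \<open>Orthonormality leaves the diagonal of the double sum, which cancels one of the
    two cross sums.\<close>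
  also have "\<dots> = (\<integral>x. f x * cnj (f x) \<partial>M) - (\<Sum>i\<in>I. b i * cnj (b i))"
    using I by (simp add: if_distrib[of "\<lambda>u. _ * u"] mult.commute cong: if_cong)
  finally have *: "(\<integral>x. h x * cnj (h x) \<partial>M) = (\<integral>x. f x * cnj (f x) \<partial>M) - (\<Sum>i\<in>I. b i * cnj (b i))" .
  have "complex_of_real (\<integral>x. (cmod (h x))\<^sup>2 \<partial>M)
      = complex_of_real ((\<integral>x. (cmod (f x))\<^sup>2 \<partial>M) - (\<Sum>i\<in>I. (cmod (b i))\<^sup>2))"
    using * unfolding complex_norm_square[symmetric] by (simp flip: of_real_power)
  then have "(\<integral>x. (cmod (h x))\<^sup>2 \<partial>M) = (\<integral>x. (cmod (f x))\<^sup>2 \<partial>M) - (\<Sum>i\<in>I. (cmod (b i))\<^sup>2)"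
    unfolding of_real_eq_iff .
  moreover have "0 \<le> (\<integral>x. (cmod (h x))\<^sup>2 \<partial>M)"
    by simp
  ultimately show ?thesis
    unfolding b_def by linarith
qed

section \<open>Exchange of integrals, and the sinc kernel as a Fourier integral\<close>

text \<open>The integrand is dominated by \<open>B\<close> times \<open>u x * v y\<close>, which is
  integrable on the plane. This form serves both the symmetry of the operator and the exchange of
  space and frequency integrals.\<close>

lemma Fubini_bounded_kernel:
  fixes u v :: "real \<Rightarrow> complex" and h :: "real \<Rightarrow> real \<Rightarrow> complex"
  assumes u: "integrable lborel u" and v: "integrable lborel v"
    and h: "(\<lambda>(x, y). h x y) \<in> borel_measurable (borel \<Otimes>\<^sub>M borel)"
    and B: "\<And>x y. cmod (h x y) \<le> B"
  shows "(\<integral>x. u x * (\<integral>y. h x y * v y \<partial>lborel) \<partial>lborel) = (\<integral>y. v y * (\<integral>x. h x y * u x \<partial>lborel) \<partial>lborel)"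
proof -
  have [measurable]: "u \<in> borel_measurable borel" "v \<in> borel_measurable borel"
    using u v by auto
  note h[measurable]
  have uv: "integrable (lborel \<Otimes>\<^sub>M lborel) (\<lambda>(x, y). u x * v y)"
    by (rule lborel_pair.Fubini_integrable) (auto intro!: AE_I2 integrable_mult_left integrable_norm
        u v simp: norm_mult)
  have "integrable (lborel \<Otimes>\<^sub>M lborel) (\<lambda>(x, y). u x * h x y * v y)"
  proof (rule Bochner_Integration.integrable_bound)
    show "integrable (lborel \<Otimes>\<^sub>M lborel) (\<lambda>z. B *\<^sub>R (case z of (x, y) \<Rightarrow> u x * v y))"
      by (intro integrable_scaleR_right uv)
    have "cmod (h x y) \<le> \<bar>B\<bar>" for x y
      using B[of x y] by linarith
    then show "AE z in lborel \<Otimes>\<^sub>M lborel. norm (case z of (x, y) \<Rightarrow> u x * h x y * v y)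
        \<le> norm (B *\<^sub>R (case z of (x, y) \<Rightarrow> u x * v y))"
      by (auto intro!: AE_I2 mult_right_mono mult_left_mono simp: norm_mult mult.assoc mult.left_commute[of "cmod (u _)"])
  qed simp
  from lborel_pair.Fubini_integral[OF this]
  have "(\<integral>y. (\<integral>x. u x * h x y * v y \<partial>lborel) \<partial>lborel) = (\<integral>x. (\<integral>y. u x * h x y * v y \<partial>lborel) \<partial>lborel)"
    by simp
  also have "(\<lambda>x. \<integral>y. u x * h x y * v y \<partial>lborel) = (\<lambda>x. u x * (\<integral>y. h x y * v y \<partial>lborel))"
    by (simp add: mult.assoc)
  also have "(\<lambda>y. \<integral>x. u x * h x y * v y \<partial>lborel) = (\<lambda>y. v y * (\<integral>x. h x y * u x \<partial>lborel))"
    by (simp add: ac_simps flip: integral_mult_right_zero)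
  finally show ?thesis by simp
qed

lemma lborel_integral_cis:
  fixes a u v :: real
  assumes "a \<noteq> 0" "u \<le> v"
  shows "(\<integral>x. indicator {u..v} x *\<^sub>R cis (a * x) \<partial>lborel) = (cis (a * v) - cis (a * u)) / (\<i> * a)"
proof -
  have "(\<integral>x. indicator {u..v} x *\<^sub>R cis (a * x) \<partial>lborel) = cis (a * v) / (\<i> * a) - cis (a * u) / (\<i> * a)"
  proof (rule integral_FTC_atLeastAtMost[OF \<open>u \<le> v\<close>])
    fix x
    show "((\<lambda>x. cis (a * x) / (\<i> * a)) has_vector_derivative cis (a * x)) (at x within {u..v})"
      using \<open>a \<noteq> 0\<close> unfolding has_vector_derivative_def
      by (auto intro!: derivative_eq_intros simp: scaleR_conv_of_real fun_eq_iff complex_eq_iff)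
  qed (intro continuous_intros)
  then show ?thesis
    by (simp add: diff_divide_distrib)
qed

text \<open>Integrating the exponential over the symmetric band leaves only the sine. This is how
  the Fourier transform of an eigenfunction enters the bound on its eigenvalue.\<close>

lemma sinc_kernel_eq_integral:
  "complex_of_real (sinc_kernel x y) = (\<integral>s. indicator {-1/2..1/2} s *\<^sub>R cis (2 * pi * (x - y) * s) \<partial>lborel)"
proof (cases "x = y")
  case True
  then show ?thesis by (simp add: sinc_kernel_def one_complex.code[symmetric] flip: scaleR_conv_of_real)
next
  case False
  define a where "a = 2 * pi * (x - y)"
  have "a \<noteq> 0" using False by (simp add: a_def)
  have "cis (a * (1 / 2)) - cis (a * (- 1 / 2)) = 2 * \<i> * sin (a / 2)"
    by (simp add: complex_eq_iff)
  then have "(\<integral>s. indicator {-1/2..1/2} s *\<^sub>R cis (a * s) \<partial>lborel) = complex_of_real (2 * sin (a / 2) / a)"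
    using \<open>a \<noteq> 0\<close> by (subst lborel_integral_cis) (simp_all add: field_simps)
  also have "2 * sin (a / 2) / a = sinc_kernel x y"
    using False by (simp add: sinc_kernel_def a_def)
  finally show ?thesis
    by (simp add: a_def)
qed

lemma borel_measurable_cis [measurable (raw)]:
  "f \<in> borel_measurable M \<Longrightarrow> (\<lambda>x. cis (f x)) \<in> borel_measurable M"
  by (rule borel_measurable_continuous_on[OF continuous_on_cis[OF continuous_on_id]])

lemma borel_measurable_sinc_kernel_comp [measurable (raw)]:
  assumes [measurable]: "f \<in> borel_measurable M" "g \<in> borel_measurable M"
  shows "(\<lambda>x. sinc_kernel (f x) (g x)) \<in> borel_measurable M"
  unfolding sinc_kernel_def by measurable

lemma abs_sinc_kernel_le_1: "\<bar>sinc_kernel x y\<bar> \<le> 1"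
proof (cases "x = y")
  case False
  then have "\<bar>sin (pi * (x - y))\<bar> \<le> \<bar>pi * (x - y)\<bar>"
    by (intro abs_sin_x_le_abs_x)
  then show ?thesis
    using False by (simp add: sinc_kernel_def field_simps)
qed (simp add: sinc_kernel_def)

lemma sinc_kernel_commute: "sinc_kernel x y = sinc_kernel y x"
proof -
  have "sin (pi * (x - y)) = - sin (pi * (y - x))"
    by (simp flip: sin_minus add: algebra_simps)
  then show ?thesis
    by (auto simp: sinc_kernel_def divide_simps algebra_simps)
qed

section \<open>Normalized eigenfunctions and their orthogonality\<close>

text \<open>Eigenfunctions are normalized and extended by zero, so that all integrals are over the line.\<close>

definition S_eigenfn :: "real \<Rightarrow> real \<Rightarrow> (real \<Rightarrow> complex) \<Rightarrow> bool" where
  "S_eigenfn c t g \<longleftrightarrow> g \<in> borel_measurable borel \<and> integrable lborel (\<lambda>x. (cmod (g x))\<^sup>2) \<and>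
     (\<forall>x. x \<notin> {0<..<c} \<longrightarrow> g x = 0) \<and> (\<integral>x. (cmod (g x))\<^sup>2 \<partial>lborel) = 1 \<and>
     (AE x in lborel. x \<in> {0<..<c} \<longrightarrow>
        (\<integral>y. complex_of_real (sinc_kernel x y) * g y \<partial>lborel) = complex_of_real t * g x)"

lemma S_eigenfnD:
  assumes "S_eigenfn c t g"
  shows "g \<in> borel_measurable borel" "integrable lborel (\<lambda>x. (cmod (g x))\<^sup>2)"
    "x \<notin> {0<..<c} \<Longrightarrow> g x = 0" "(\<integral>x. (cmod (g x))\<^sup>2 \<partial>lborel) = 1"
    "AE x in lborel. x \<in> {0<..<c} \<longrightarrow>
        (\<integral>y. complex_of_real (sinc_kernel x y) * g y \<partial>lborel) = complex_of_real t * g x"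
  using assms unfolding S_eigenfn_def by auto

text \<open>Extend by zero and divide by the norm, which is positive because an eigenfunction does
  not vanish almost everywhere.\<close>

lemma ex_S_eigenfn:
  assumes "t \<in> S_eigenvalues c"
  shows "\<exists>g. S_eigenfn c t g"
proof -
  obtain f where f: "f \<in> square_integrable_fns c"
    and nz: "\<not> (AE x in interval_measure_on c. f x = 0)"
    and ev: "AE x in interval_measure_on c. S_op c f x = complex_of_real t * f x"
    using assms unfolding S_eigenvalues_def by blast
  define g where "g x = indicator {0<..<c} x *\<^sub>R f x" for x
  have [measurable]: "g \<in> borel_measurable borel"
    using f by (simp add: square_integrable_fns_def interval_measure_on_def
        borel_measurable_restrict_space_iff g_def[abs_def])
  have sq: "indicator {0<..<c} x *\<^sub>R (cmod (f x))\<^sup>2 = (cmod (g x))\<^sup>2" for x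
    by (simp add: g_def indicator_def)
  have g2: "integrable lborel (\<lambda>x. (cmod (g x))\<^sup>2)"
    using f by (simp add: square_integrable_fns_def interval_measure_on_def integrable_restrict_space
        flip: sq)
  define I where "I = (\<integral>x. (cmod (g x))\<^sup>2 \<partial>lborel)"
  have "\<not> (AE x in lborel. x \<in> {0<..<c} \<longrightarrow> f x = 0)"
    using nz unfolding interval_measure_on_def by (subst (asm) AE_restrict_space_iff) simp_all
  then have "\<not> (AE x in lborel. g x = 0)"
    by (rule contrapos_nn) (auto elim!: eventually_mono simp: g_def)
  then have "I \<noteq> 0"
    using integral_nonneg_eq_0_iff_AE[OF g2] by (simp add: I_def)
  moreover have "0 \<le> I"
    by (simp add: I_def)
  ultimately have I: "I > 0" by simp
  have op: "S_op c f x = (\<integral>y. complex_of_real (sinc_kernel x y) * g y \<partial>lborel)" for x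
    by (simp add: S_op_def interval_measure_on_def integral_restrict_space g_def)
  define k where "k = complex_of_real (1 / sqrt I)"
  have k: "(cmod k)\<^sup>2 = 1 / I"
    using I by (simp add: k_def norm_divide power_divide)
  have "S_eigenfn c t (\<lambda>x. k * g x)"
    unfolding S_eigenfn_def
  proof (intro conjI)
    show "(\<lambda>x. k * g x) \<in> borel_measurable borel" by simp
    show "integrable lborel (\<lambda>x. (cmod (k * g x))\<^sup>2)"
      using g2 by (simp add: norm_mult power_mult_distrib)
    show "(\<integral>x. (cmod (k * g x))\<^sup>2 \<partial>lborel) = 1"
      using I by (simp add: norm_mult power_mult_distrib k flip: I_def)
    show "\<forall>x. x \<notin> {0<..<c} \<longrightarrow> k * g x = 0"
      by (simp add: g_def)
    have "AE x in lborel. x \<in> {0<..<c} \<longrightarrow> S_op c f x = complex_of_real t * f x"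
      using ev unfolding interval_measure_on_def by (subst (asm) AE_restrict_space_iff) simp_all
    then show "AE x in lborel. x \<in> {0<..<c} \<longrightarrow>
        (\<integral>y. complex_of_real (sinc_kernel x y) * (k * g y) \<partial>lborel) = complex_of_real t * (k * g x)"
      by eventually_elim (simp add: op mult.left_commute[of _ k], simp add: g_def)
  qed
  then show ?thesis by blast
qed

text \<open>Multiplication by the square-integrable indicator of the interval leaves
  \<open>g\<close> unchanged, so \<open>L2_mult_integrable\<close> applies.\<close>

lemma S_eigenfn_integrable:
  assumes "S_eigenfn c t g"
  shows "integrable lborel g"
proof -
  have "integrable lborel (\<lambda>x. g x * indicator {0<..<c} x)"
  proof (rule L2_mult_integrable)
    have "(\<lambda>x. (cmod (indicator {0<..<c} x))\<^sup>2) = (indicator {0<..<c} :: real \<Rightarrow> real)"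
      by (auto simp: indicator_def)
    \<comment> \<open>The case split admits negative \<open>c\<close>, for which the interval is
      empty.\<close>
    then show "integrable lborel (\<lambda>x. (cmod (indicator {0<..<c} x))\<^sup>2)"
      by (cases "0 \<le> c") simp_all
  qed (use S_eigenfnD[OF assms] in auto)
  also have "(\<lambda>x. g x * indicator {0<..<c} x) = g"
    using S_eigenfnD(3)[OF assms] by (auto simp: indicator_def fun_eq_iff)
  finally show ?thesis .
qed

text \<open>The eigenvalue equation is known only inside the interval, but outside it
  \<open>cnj (g x)\<close> vanishes. Two different eigenfunctions give orthogonality;
  \<open>f = g\<close> gives the eigenvalue as a quadratic form.\<close>

lemma S_eigenfn_inner:
  assumes f: "S_eigenfn c t f" and g: "S_eigenfn c s g"
  shows "(\<integral>x. cnj (g x) * (\<integral>y. complex_of_real (sinc_kernel x y) * f y \<partial>lborel) \<partial>lborel) =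
         complex_of_real t * (\<integral>x. f x * cnj (g x) \<partial>lborel)"
proof -
  note [measurable] = S_eigenfnD(1)[OF f] S_eigenfnD(1)[OF g]
  have "(\<integral>x. cnj (g x) * (\<integral>y. complex_of_real (sinc_kernel x y) * f y \<partial>lborel) \<partial>lborel) =
        (\<integral>x. complex_of_real t * (f x * cnj (g x)) \<partial>lborel)"
  proof (rule integral_cong_AE)
    show "AE x in lborel. cnj (g x) * (\<integral>y. complex_of_real (sinc_kernel x y) * f y \<partial>lborel) =
        complex_of_real t * (f x * cnj (g x))"
      using S_eigenfnD(5)[OF f] by eventually_elim (use S_eigenfnD(3)[OF g] in \<open>auto simp: mult_ac\<close>)
  qed measurable
  then show ?thesis by simp
qed

text \<open>Self-adjointness: the kernel is real and symmetric, so the operator can be moved from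
  \<open>f\<close> to \<open>g\<close>, and the inner product times \<open>t\<close> equals the
  inner product times \<open>s\<close>.\<close>

lemma S_eigenfn_orthogonal:
  assumes f: "S_eigenfn c t f" and g: "S_eigenfn c s g" and "t \<noteq> s"
  shows "(\<integral>x. f x * cnj (g x) \<partial>lborel) = 0"
proof -
  note [measurable] = S_eigenfnD(1)[OF f] S_eigenfnD(1)[OF g]
  have "complex_of_real t * (\<integral>x. f x * cnj (g x) \<partial>lborel) =
     (\<integral>x. cnj (g x) * (\<integral>y. complex_of_real (sinc_kernel x y) * f y \<partial>lborel) \<partial>lborel)"
    by (rule S_eigenfn_inner[OF f g, symmetric])
  also have "\<dots> = (\<integral>y. f y * (\<integral>x. complex_of_real (sinc_kernel x y) * cnj (g x) \<partial>lborel) \<partial>lborel)"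
  proof (rule Fubini_bounded_kernel[where B = 1])
    show "integrable lborel (\<lambda>x. cnj (g x))" "integrable lborel f"
      using S_eigenfn_integrable f g by (simp_all add: integrable_cnj)
    show "cmod (complex_of_real (sinc_kernel x y)) \<le> 1" for x y
      using abs_sinc_kernel_le_1 by simp
  qed measurable
  \<comment> \<open>The conjugate is taken outside so that \<open>S_eigenfn_inner\<close> applies
    with \<open>f\<close> and \<open>g\<close> exchanged; the real number \<open>s\<close> is not
    changed by it.\<close>
  also have "\<dots> = cnj (\<integral>y. cnj (f y) * (\<integral>x. complex_of_real (sinc_kernel y x) * g x \<partial>lborel) \<partial>lborel)"
    by (simp add: sinc_kernel_commute flip: Bochner_Integration.integral_cnj)
  also have "\<dots> = complex_of_real s * (\<integral>x. f x * cnj (g x) \<partial>lborel)"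
    unfolding S_eigenfn_inner[OF g f] by (simp add: mult.commute flip: Bochner_Integration.integral_cnj)
  finally show ?thesis using \<open>t \<noteq> s\<close> by simp
qed

lemma S_eigenfn_norm:
  assumes "S_eigenfn c t g"
  shows "(\<integral>x. g x * cnj (g x) \<partial>lborel) = 1"
  using S_eigenfnD(4)[OF assms] unfolding complex_norm_square[symmetric] by (simp flip: of_real_power)

section \<open>Finitely many eigenvalues above a positive threshold\<close>

text \<open>For almost every \<open>x\<close> in the interval, the numbers \<open>t * g t x\<close>
  are Bessel coefficients of the kernel row at \<open>x\<close>, whose squared norm is at most
  \<open>c\<close>. Integrating over \<open>x\<close> gives a second factor \<open>c\<close>, so a
  finite set of eigenvalues above \<open>a\<close> has at most \<open>c\<^sup>2 / a\<^sup>2\<close>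
  elements.\<close>

lemma finite_S_eigenvalues_greater:
  assumes "0 < a" "0 < c"
  shows "finite {t \<in> S_eigenvalues c. a < t}"
proof -
  have "card T \<le> nat \<lfloor>c\<^sup>2 / a\<^sup>2\<rfloor>" if T: "T \<subseteq> {t \<in> S_eigenvalues c. a < t}" "finite T" for T
  proof -
    define g where "g t = (SOME g. S_eigenfn c t g)" for t
    have g: "S_eigenfn c t (g t)" if "t \<in> T" for t
      using ex_S_eigenfn[of t c] T that unfolding g_def by (metis (mono_tags, lifting) mem_Collect_eq subsetD someI_ex)
    let ?K = "\<lambda>x y. complex_of_real (indicator {0<..<c} y * sinc_kernel x y)"
    have K2: "(cmod (?K x y))\<^sup>2 \<le> indicator {0<..<c} y" for x y
      using abs_sinc_kernel_le_1[of x y] by (auto simp: indicator_def abs_square_le_1)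
    have intK: "integrable lborel (\<lambda>y. (cmod (?K x y))\<^sup>2)" for x
      by (rule Bochner_Integration.integrable_bound[OF integrable_real_indicator[of "{0<..<c}" lborel]])
        (use K2 \<open>0 < c\<close> in \<open>auto intro!: AE_I2\<close>)
    have Bessel: "(\<Sum>t\<in>T. (cmod (\<integral>y. complex_of_real (sinc_kernel x y) * g t y \<partial>lborel))\<^sup>2) \<le> c" for x
    proof -
      \<comment> \<open>Bessel's inequality pairs with conjugates, so the orthonormal system is
        \<open>cnj (g t y)\<close>. The indicator may be inserted since \<open>g t\<close> vanishes
        off the interval.\<close>
      have "(\<lambda>y. complex_of_real (sinc_kernel x y) * g t y) = (\<lambda>y. ?K x y * cnj (cnj (g t y)))" if "t \<in> T" for t
        using S_eigenfnD(3)[OF g[OF that]] by (auto simp: fun_eq_iff indicator_def)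
      then have "(\<Sum>t\<in>T. (cmod (\<integral>y. complex_of_real (sinc_kernel x y) * g t y \<partial>lborel))\<^sup>2) =
          (\<Sum>t\<in>T. (cmod (\<integral>y. ?K x y * cnj (cnj (g t y)) \<partial>lborel))\<^sup>2)"
        by (simp cong: sum.cong)
      also have "\<dots> \<le> (\<integral>y. (cmod (?K x y))\<^sup>2 \<partial>lborel)"
      proof (rule Bessel_inequality_L2[OF \<open>finite T\<close>])
        show "(\<integral>x. cnj (g i x) * cnj (cnj (g j x)) \<partial>lborel) = (if i = j then 1 else 0)"
          if "i \<in> T" "j \<in> T" for i j
          using S_eigenfn_norm[OF g] S_eigenfn_orthogonal[OF g g, of j i] that
          by (simp add: mult.commute)
        show "(\<lambda>x. cnj (g i x)) \<in> borel_measurable lborel"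
          "integrable lborel (\<lambda>x. (cmod (cnj (g i x)))\<^sup>2)" if "i \<in> T" for i
          using S_eigenfnD[OF g[OF that]] by auto
      qed (use intK in auto)
      also have "(\<integral>y. (cmod (?K x y))\<^sup>2 \<partial>lborel) \<le> (\<integral>y. indicator {0<..<c} y \<partial>lborel)"
        by (intro integral_mono intK K2) (use \<open>0 < c\<close> in auto)
      also have "\<dots> = c"
        using \<open>0 < c\<close> by simp
      finally show ?thesis .
    qed
    \<comment> \<open>The exceptional null set depends on \<open>t\<close>; as \<open>T\<close> is
      finite, one null set serves all.\<close>
    have "AE x in lborel. \<forall>t\<in>T. x \<in> {0<..<c} \<longrightarrow>
        (\<integral>y. complex_of_real (sinc_kernel x y) * g t y \<partial>lborel) = complex_of_real t * g t x"
      using S_eigenfnD(5)[OF g] \<open>finite T\<close> by (intro AE_finite_allI) auto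
    then have AE: "AE x in lborel. (\<Sum>t\<in>T. t\<^sup>2 * (cmod (g t x))\<^sup>2) \<le> c * indicator {0<..<c} x"
    proof eventually_elim
      case (elim x)
      show ?case
      proof (cases "x \<in> {0<..<c}")
        case True
        then have "(\<Sum>t\<in>T. t\<^sup>2 * (cmod (g t x))\<^sup>2) =
            (\<Sum>t\<in>T. (cmod (\<integral>y. complex_of_real (sinc_kernel x y) * g t y \<partial>lborel))\<^sup>2)"
          using elim by (intro sum.cong) (auto simp: norm_mult power_mult_distrib)
        then show ?thesis using Bessel[of x] True by simp
      next
        case False
        then have "(\<Sum>t\<in>T. t\<^sup>2 * (cmod (g t x))\<^sup>2) = 0"
          using S_eigenfnD(3)[OF g] by (intro sum.neutral) auto
        then show ?thesis using False by simp
      qed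
    qed
    have int: "integrable lborel (\<lambda>x. t\<^sup>2 * (cmod (g t x))\<^sup>2)" if "t \<in> T" for t
      using S_eigenfnD(2)[OF g[OF that]] by simp
    have "real (card T) * a\<^sup>2 \<le> (\<Sum>t\<in>T. t\<^sup>2)"
      using T \<open>0 < a\<close> by (intro sum_bounded_below) (auto intro!: power_mono)
    also have "\<dots> = (\<integral>x. (\<Sum>t\<in>T. t\<^sup>2 * (cmod (g t x))\<^sup>2) \<partial>lborel)"
      using int S_eigenfnD(4)[OF g] by (simp add: Bochner_Integration.integral_sum)
    also have "\<dots> \<le> (\<integral>x. c * indicator {0<..<c} x \<partial>lborel)"
      by (intro integral_mono_AE AE Bochner_Integration.integrable_sum int) (use \<open>0 < c\<close> in auto)
    also have "\<dots> = c\<^sup>2"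
      using \<open>0 < c\<close> by (simp add: power2_eq_square)
    finally have "real (card T) \<le> c\<^sup>2 / a\<^sup>2"
      using \<open>0 < a\<close> by (simp add: field_simps)
    then show ?thesis
      by (simp add: le_nat_iff le_floor_iff)
  qed
  then show ?thesis
    using finite_if_finite_subsets_card_bdd by blast
qed

section \<open>The upper bound 1 for the eigenvalues\<close>

text \<open>On \<open>{0..real N}\<close> the exponentials of frequencies \<open>a + k / N\<close>,
  divided by \<open>sqrt N\<close>, are orthonormal; the common shift \<open>a\<close> cancels in
  their inner products. The coefficients of \<open>g\<close> are samples of its Fourier transform
  divided by \<open>sqrt N\<close>, whence the factor \<open>N\<close>.\<close>

lemma Fourier_Bessel:
  fixes g :: "real \<Rightarrow> complex" and N :: nat
  assumes [measurable]: "g \<in> borel_measurable borel" and g2: "integrable lborel (\<lambda>x. (cmod (g x))\<^sup>2)"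
    and supp: "\<And>x. x \<notin> {0..real N} \<Longrightarrow> g x = 0" and N: "N > 0"
  shows "(\<Sum>k<N. (cmod (\<integral>y. cis (- 2 * pi * (a + k / N) * y) * g y \<partial>lborel))\<^sup>2)
      \<le> N * (\<integral>x. (cmod (g x))\<^sup>2 \<partial>lborel)"
proof -
  define e where "e k x = complex_of_real (indicator {0..real N} x / sqrt N) * cis (2 * pi * (a + k / N) * x)"
    for k :: nat and x :: real
  have e2: "(cmod (e k x))\<^sup>2 = indicator {0..real N} x / N" for k x
    by (simp add: e_def norm_mult norm_divide power_divide indicator_def)
  have ee: "e j x * cnj (e k x) = (indicator {0..real N} x *\<^sub>R cis (2 * pi * ((real j - real k) / N) * x)) / of_nat N" for j k x
  proof -
    have "cis (2 * pi * (a + j / N) * x) * cnj (cis (2 * pi * (a + k / N) * x)) =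
        cis (2 * pi * ((real j - real k) / N) * x)"
      by (simp add: cis_cnj cis_mult algebra_simps diff_divide_distrib)
    moreover have "complex_of_real (1 / sqrt N) * complex_of_real (1 / sqrt N) = 1 / of_nat N"
      by (simp flip: of_real_mult)
    moreover have "e j x * cnj (e k x) = indicator {0..real N} x *\<^sub>R
        ((complex_of_real (1 / sqrt N) * complex_of_real (1 / sqrt N)) *
         (cis (2 * pi * (a + j / N) * x) * cnj (cis (2 * pi * (a + k / N) * x))))"
      by (simp add: e_def indicator_def)
    ultimately show ?thesis
      by (simp add: scaleR_conv_of_real)
  qed
  have "(\<integral>x. g x * cnj (e k x) \<partial>lborel) =
      (\<integral>y. cis (- 2 * pi * (a + k / N) * y) * g y \<partial>lborel) / complex_of_real (sqrt N)" for k
  proof -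
    have "g x * cnj (e k x) = (cis (- 2 * pi * (a + k / N) * x) * g x) / complex_of_real (sqrt N)" for x
      using supp[of x] by (cases "x \<in> {0..real N}") (simp_all add: e_def cis_cnj)
    then show ?thesis by simp
  qed
  then have "(\<Sum>k<N. (cmod (\<integral>y. cis (- 2 * pi * (a + k / N) * y) * g y \<partial>lborel))\<^sup>2) / N =
      (\<Sum>k<N. (cmod (\<integral>x. g x * cnj (e k x) \<partial>lborel))\<^sup>2)"
    by (simp add: norm_divide power_divide sum_divide_distrib)
  also have "\<dots> \<le> (\<integral>x. (cmod (g x))\<^sup>2 \<partial>lborel)"
  proof (rule Bessel_inequality_L2)
    show "e k \<in> borel_measurable lborel" for k
      unfolding e_def by measurable
    show "integrable lborel (\<lambda>x. (cmod (e k x))\<^sup>2)" for k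
      unfolding e2 by (intro integrable_divide integrable_real_indicator) auto
    show "(\<integral>x. e j x * cnj (e k x) \<partial>lborel) = (if j = k then 1 else 0)" if "j \<in> {..<N}" "k \<in> {..<N}" for j k
    proof (cases "j = k")
      case True
      then show ?thesis using N unfolding ee by (simp add: scaleR_conv_of_real)
    next
      case False
      \<comment> \<open>The interval holds a whole number of periods, so the antiderivative agrees
        at both ends.\<close>
      have "cis (2 * pi * ((real j - real k) / N) * N) = cis (2 * pi * real_of_int (int j - int k))"
        using N by simp
      also have "\<dots> = 1"
        by (rule cis_multiple_2pi) simp
      finally have "cis (2 * pi * ((real j - real k) / N) * N) = 1" .
      then have "(\<integral>x. indicator {0..real N} x *\<^sub>R cis (2 * pi * ((real j - real k) / N) * x) \<partial>lborel) = 0"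
        using False N by (subst lborel_integral_cis) auto
      then show ?thesis using False unfolding ee by simp
    qed
  qed (use g2 in auto)
  finally show ?thesis
    using N by (simp add: field_simps)
qed

text \<open>Translating \<open>N\<close> pieces of length \<open>1 / N\<close> onto one of them
  leaves the integral of a sum bounded by \<open>N * C\<close> over a set of measure
  \<open>1 / N\<close>. The bound \<open>B\<close> provides integrability.\<close>

lemma integral_unit_interval_le:
  fixes G :: "real \<Rightarrow> real" and N :: nat and a B C :: real
  assumes [measurable]: "G \<in> borel_measurable borel" and G0: "\<And>s. 0 \<le> G s" and GB: "\<And>s. G s \<le> B"
    and N: "N > 0" and sum: "\<And>s. (\<Sum>k<N. G (s + k / N)) \<le> N * C"
  shows "(\<integral>s. indicator {a..a + 1} s * G s \<partial>lborel) \<le> C"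
proof -
  let ?I = "\<lambda>s. indicator {0..1 / real N} s :: real"
  have int: "integrable lborel (\<lambda>s. indicator {u..v} s * G (b + s))" for u v b :: real
  proof (rule Bochner_Integration.integrable_bound)
    show "integrable lborel (\<lambda>s. B * indicator {u..v} s)"
      by (cases "u \<le> v") auto
    have "G s \<le> \<bar>B\<bar>" for s using GB[of s] by linarith
    then show "AE s in lborel. norm (indicator {u..v} s * G (b + s)) \<le> norm (B * indicator {u..v} s)"
      using G0 by (auto simp: indicator_def intro!: AE_I2)
  qed measurable
  have shift: "integrable lborel (\<lambda>s. ?I (s - (a + k / N)) * G s)" 
    "(\<integral>s. ?I (s - (a + k / N)) * G s \<partial>lborel) = (\<integral>s. ?I s * G (a + s + k / N) \<partial>lborel)" for k :: nat
  proof -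
    have "?I (s - (a + k / N)) = indicator {a + k / N .. a + k / N + 1 / N} s" for s
      by (auto simp: indicator_def)
    then show "integrable lborel (\<lambda>s. ?I (s - (a + k / N)) * G s)"
      using int[of _ _ 0] by simp
    show "(\<integral>s. ?I (s - (a + k / N)) * G s \<partial>lborel) = (\<integral>s. ?I s * G (a + s + k / N) \<partial>lborel)"
      by (subst lborel_integral_real_affine[of 1 _ "a + k / N"]) (simp_all add: add_ac)
  qed
  \<comment> \<open>The closed pieces share endpoints, so this is an inequality; it uses that
    \<open>G\<close> is nonnegative.\<close>
  have cover: "indicator {a..a + 1} s * G s \<le> (\<Sum>k<N. ?I (s - (a + k / N)) * G s)" for s
  proof (cases "s \<in> {a..a + 1}")
    case True
    \<comment> \<open>The minimum catches \<open>s = a + 1\<close>, where the floor is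
      \<open>N\<close> but the last piece has index \<open>N - 1\<close>.\<close>
    define k where "k = min (N - 1) (nat \<lfloor>(s - a) * N\<rfloor>)"
    have "k < N" using N by (auto simp: k_def)
    have "real k \<le> (s - a) * N \<and> (s - a) * N \<le> k + 1"
    proof (cases "nat \<lfloor>(s - a) * N\<rfloor> \<le> N - 1")
      case le: True
      then have "k = nat \<lfloor>(s - a) * N\<rfloor>" by (simp add: k_def)
      moreover have "0 \<le> (s - a) * N" using True by simp
      ultimately show ?thesis by linarith
    next
      case False
      then have "real (N - 1) \<le> (s - a) * N" by linarith
      moreover have "(s - a) * N \<le> real N"
        using True mult_right_mono[of "s - a" 1 "real N"] by simp
      moreover have "k = N - 1" using False by (simp add: k_def)
      ultimately show ?thesis using N by (simp add: of_nat_diff)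
    qed
    then have "k / N \<le> s - a \<and> s - a \<le> k / N + 1 / N"
      using N by (simp add: pos_divide_le_eq pos_le_divide_eq flip: add_divide_distrib)
    then have "?I (s - (a + k / N)) = 1"
      by (simp add: indicator_def)
    then have "indicator {a..a + 1} s * G s = ?I (s - (a + k / N)) * G s"
      using True by simp
    also have "\<dots> \<le> (\<Sum>k<N. ?I (s - (a + k / N)) * G s)"
      using \<open>k < N\<close> G0 by (intro member_le_sum) auto
    finally show ?thesis .
  next
    case False
    then show ?thesis using G0 by (simp add: sum_nonneg)
  qed
  have "(\<integral>s. indicator {a..a + 1} s * G s \<partial>lborel) \<le> (\<integral>s. (\<Sum>k<N. ?I (s - (a + k / N)) * G s) \<partial>lborel)"
    by (intro integral_mono cover Bochner_Integration.integrable_sum shift) (use int[of _ _ 0] in simp)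
  also have "\<dots> = (\<Sum>k<N. \<integral>s. ?I s * G (a + s + k / N) \<partial>lborel)"
    by (subst Bochner_Integration.integral_sum) (simp_all only: shift)
  also have "\<dots> = (\<integral>s. (\<Sum>k<N. ?I s * G (a + s + k / N)) \<partial>lborel)"
    using int[of 0 "1 / real N" "a + real _ / real N"]
    by (intro Bochner_Integration.integral_sum[symmetric]) (simp add: add_ac)
  also have "\<dots> \<le> (\<integral>s. ?I s * (N * C) \<partial>lborel)"
  proof (rule integral_mono)
    show "integrable lborel (\<lambda>s. \<Sum>k<N. ?I s * G (a + s + k / N))"
      using int[of 0 "1 / real N" "a + real _ / real N"]
      by (intro Bochner_Integration.integrable_sum) (simp add: add_ac)
    show "(\<Sum>k<N. ?I s * G (a + s + k / N)) \<le> ?I s * (N * C)" for s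
      using sum[of "a + s"] by (simp add: indicator_def flip: sum_distrib_left)
  qed simp
  also have "\<dots> = C"
    using N by simp
  finally show ?thesis .
qed

text \<open>Two exchanges of integrals express \<open>t\<close> as the integral of the squared
  modulus of \<open>F\<close> over the band. Then \<open>integral_unit_interval_le\<close> applies
  with \<open>C = 1\<close>, its hypothesis on sums being \<open>Fourier_Bessel\<close> for a
  function of norm 1.\<close>

lemma S_eigenvalues_le_1:
  assumes "t \<in> S_eigenvalues c"
  shows "t \<le> 1"
proof -
  obtain g where g: "S_eigenfn c t g"
    using ex_S_eigenfn[OF assms] ..
  note [measurable] = S_eigenfnD(1)[OF g]
  have gi: "integrable lborel g" by (rule S_eigenfn_integrable[OF g])
  define F where "F s = (\<integral>y. cis (- 2 * pi * s * y) * g y \<partial>lborel)" for s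
  have [measurable]: "F \<in> borel_measurable borel"
    unfolding F_def by measurable
  have F_bound: "cmod (F s) \<le> (\<integral>y. cmod (g y) \<partial>lborel)" for s
    unfolding F_def using integral_norm_bound[of lborel "\<lambda>y. cis (- 2 * pi * s * y) * g y"]
    by (simp add: norm_mult)
  define J where "J s = complex_of_real (indicator {-1/2..1/2} s)" for s :: real
  have [measurable]: "J \<in> borel_measurable borel"
    unfolding J_def by measurable
  have J: "integrable lborel J"
    unfolding J_def by (intro integrable_of_real integrable_real_indicator) auto
  have JF: "integrable lborel (\<lambda>s. J s * F s)"
  proof (rule Bochner_Integration.integrable_bound)
    show "integrable lborel (\<lambda>s. complex_of_real (\<integral>y. cmod (g y) \<partial>lborel) * J s)"
      using J by simp
    show "AE s in lborel. norm (J s * F s) \<le> norm (complex_of_real (\<integral>y. cmod (g y) \<partial>lborel) * J s)"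
      using F_bound by (auto intro!: AE_I2 simp: J_def norm_mult indicator_def)
  qed measurable
  have modulate: "(\<integral>y. cis (2 * pi * (x - y) * s) * g y \<partial>lborel) = cis (2 * pi * x * s) * F s" for x s
  proof -
    have "cis (2 * pi * x * s) * cis (- 2 * pi * s * y) = cis (2 * pi * (x - y) * s)" for y
      by (simp add: cis_mult algebra_simps)
    then have "cis (2 * pi * (x - y) * s) * g y = cis (2 * pi * x * s) * (cis (- 2 * pi * s * y) * g y)" for y
      by (simp only: mult.assoc[symmetric])
    then show ?thesis
      by (simp only: F_def integral_mult_right_zero)
  qed
  have cnj_F: "(\<integral>x. cis (2 * pi * x * s) * cnj (g x) \<partial>lborel) = cnj (F s)" for s
    unfolding F_def by (simp add: cis_cnj mult_ac flip: Bochner_Integration.integral_cnj)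
  \<comment> \<open>The operator takes the Fourier transform, cuts it to the band and transforms
    back.\<close>
  have S: "(\<integral>y. complex_of_real (sinc_kernel x y) * g y \<partial>lborel) =
      (\<integral>s. cis (2 * pi * x * s) * (J s * F s) \<partial>lborel)" for x
  proof -
    have "(\<integral>y. complex_of_real (sinc_kernel x y) * g y \<partial>lborel) =
        (\<integral>y. g y * (\<integral>s. cis (2 * pi * (x - y) * s) * J s \<partial>lborel) \<partial>lborel)"
      by (simp add: sinc_kernel_eq_integral J_def scaleR_conv_of_real mult.commute)
    also have "\<dots> = (\<integral>s. J s * (\<integral>y. cis (2 * pi * (x - y) * s) * g y \<partial>lborel) \<partial>lborel)"
      by (rule Fubini_bounded_kernel[where B = 1, OF gi J]) simp_all
    also have "\<dots> = (\<integral>s. J s * (cis (2 * pi * x * s) * F s) \<partial>lborel)"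
      by (simp only: modulate)
    finally show ?thesis by (simp only: mult.left_commute)
  qed
  have "complex_of_real t = (\<integral>x. cnj (g x) * (\<integral>y. complex_of_real (sinc_kernel x y) * g y \<partial>lborel) \<partial>lborel)"
    using S_eigenfn_inner[OF g g] S_eigenfn_norm[OF g] by simp
  \<comment> \<open>The second exchange: the inner integral over \<open>x\<close> is now
    \<open>cnj (F s)\<close>.\<close>
  also have "\<dots> = (\<integral>s. J s * F s * (\<integral>x. cis (2 * pi * x * s) * cnj (g x) \<partial>lborel) \<partial>lborel)"
    unfolding S by (rule Fubini_bounded_kernel[where B = 1]) (use gi JF in simp_all)
  \<comment> \<open>The endpoint \<open>1/2\<close> is written as \<open>-1/2 + 1\<close> to fit
    \<open>integral_unit_interval_le\<close>.\<close>
  also have "\<dots> = (\<integral>s. complex_of_real (indicator {-1/2..-1/2 + 1} s * (cmod (F s))\<^sup>2) \<partial>lborel)"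
    unfolding cnj_F by (simp add: J_def mult.assoc complex_norm_square del: of_real_power)
  finally have "t = (\<integral>s. indicator {-1/2..-1/2 + 1} s * (cmod (F s))\<^sup>2 \<partial>lborel)"
    unfolding integral_complex_of_real of_real_eq_iff .
  also have "\<dots> \<le> 1"
  proof -
    \<comment> \<open>\<open>c \<le> N\<close> puts the support of \<open>g\<close> into
      \<open>{0..real N}\<close>; the maximum keeps \<open>N\<close> positive whatever the sign of
      \<open>c\<close>.\<close>
    define N where "N = max 1 (nat \<lceil>c\<rceil>)"
    have N: "N > 0" "c \<le> real N" unfolding N_def by linarith+
    show ?thesis
    proof (rule integral_unit_interval_le[where G = "\<lambda>s. (cmod (F s))\<^sup>2" and N = N])
      show "(cmod (F s))\<^sup>2 \<le> (\<integral>y. cmod (g y) \<partial>lborel)\<^sup>2" for s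
        using F_bound by (intro power_mono) auto
      show "(\<Sum>k<N. (cmod (F (s + k / N)))\<^sup>2) \<le> real N * 1" for s
      proof -
        have "g x = 0" if "x \<notin> {0..real N}" for x
          using S_eigenfnD(3)[OF g, of x] N that by auto
        then show ?thesis
          unfolding F_def using Fourier_Bessel[of g N s] S_eigenfnD(1,2,4)[OF g] N by simp
      qed
    qed (use N in auto)
  qed
  finally show ?thesis .
qed

section \<open>The sequence of eigenvalues\<close>

text \<open>The inserted 0 makes the set nonempty and gives the lower bound;
  \<open>S_eigenvalues_le_1\<close> bounds the set above.\<close>

lemma eigval_mem_Icc: "eigval c n \<in> {0..1}"
proof -
  let ?X = "insert 0 (S_eigenvalues c - eigval c ` {..<n})"
  have "\<And>t. t \<in> ?X \<Longrightarrow> t \<le> 1"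
    using S_eigenvalues_le_1 by auto
  then have "0 \<le> Sup ?X" "Sup ?X \<le> 1"
    by (meson bdd_aboveI cSup_upper insertI1, meson cSup_least insert_not_empty)
  then show ?thesis
    by (simp add: eigval.simps[of c n])
qed

text \<open>The supremum is attained: for \<open>a\<close> strictly between 0 and it, only finitely
  many members exceed \<open>a\<close>, and their maximum is the supremum. Being positive, it is not
  the inserted 0.\<close>

lemma eigval_positive_mem:
  assumes "0 < c" "0 < eigval c n"
  shows "eigval c n \<in> S_eigenvalues c - eigval c ` {..<n}"
proof -
  let ?X = "insert 0 (S_eigenvalues c - eigval c ` {..<n})"
  obtain a where a: "0 < a" "a < eigval c n"
    using assms(2) dense by blast
  let ?Y = "{t \<in> ?X. a < t}"
  have Y: "?Y \<subseteq> {t \<in> S_eigenvalues c. a < t}"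
    using a by auto
  then have "finite ?Y"
    using finite_S_eigenvalues_greater[OF a(1) assms(1)] finite_subset by blast
  moreover obtain x where "x \<in> ?X" "a < x"
    using a(2) less_cSupE[of a ?X] by (auto simp: eigval.simps[of c n])
  ultimately have M: "Max ?Y \<in> ?Y" and le: "\<And>t. t \<in> ?Y \<Longrightarrow> t \<le> Max ?Y"
    using Max_in[of ?Y] by auto
  have "t \<le> Max ?Y" if "t \<in> ?X" for t
    using le[of t] M that by (cases "a < t") auto
  then have "Sup ?X = Max ?Y"
    using M by (intro cSup_eq_maximum) auto
  then have "eigval c n \<in> ?X"
    using M by (simp add: eigval.simps[of c n])
  then show ?thesis using assms(2) by auto
qed

text \<open>A positive value is an eigenvalue not listed at a smaller index, so
  \<open>eigval c\<close> is injective on these indices and maps them into a finite set.\<close>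

lemma finite_eigval_greater:
  assumes "0 < a" "0 < c"
  shows "finite {n. a < eigval c n}"
proof (rule finite_imageD)
  have mem: "eigval c n \<in> S_eigenvalues c - eigval c ` {..<n}" if "a < eigval c n" for n
    using eigval_positive_mem assms that by force
  show "finite (eigval c ` {n. a < eigval c n})"
    by (rule finite_subset[OF _ finite_S_eigenvalues_greater[OF assms]]) (use mem in auto)
  have "eigval c m \<noteq> eigval c n" if "m < n" "a < eigval c n" for m n
    using mem[OF that(2)] that(1) by (metis DiffD2 image_eqI lessThan_iff)
  then show "inj_on (eigval c) {n. a < eigval c n}"
    by (intro linorder_inj_onI) auto
qed

section \<open>Counting multi-indices\<close>

lemma prod_le_factor:
  fixes f :: "'a \<Rightarrow> real"
  assumes "finite A" "i \<in> A" "\<And>r. r \<in> A \<Longrightarrow> f r \<in> {0..1}"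
  shows "(\<Prod>r\<in>A. f r) \<le> f i"
proof -
  have "(\<Prod>r\<in>A. f r) = f i * (\<Prod>r\<in>A - {i}. f r)"
    using assms by (intro prod.remove)
  also have "\<dots> \<le> f i * 1"
    using assms by (intro mult_left_mono prod_le_1) auto
  finally show ?thesis by simp
qed

text \<open>All factors lie in \<open>{0..1}\<close>, so a product above \<delta> forces every
  factor above \<delta>, which leaves finitely many choices for each component.\<close>

lemma finite_mu_greater:
  assumes "0 < \<delta>" "0 < c"
  shows "finite {\<nu> \<in> {..<d} \<rightarrow>\<^sub>E (UNIV :: nat set). \<delta> < mu c d \<nu>}"
proof (rule finite_subset)
  show "{\<nu> \<in> {..<d} \<rightarrow>\<^sub>E (UNIV :: nat set). \<delta> < mu c d \<nu>} \<subseteq> {..<d} \<rightarrow>\<^sub>E {n. \<delta> < eigval c n}"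
  proof (clarsimp simp: PiE_iff)
    fix \<nu> :: "nat \<Rightarrow> nat" and r
    assume "\<delta> < mu c d \<nu>" "r < d"
    moreover have "mu c d \<nu> \<le> eigval c (\<nu> r)"
      unfolding mu_def using \<open>r < d\<close> by (intro prod_le_factor[of _ r "\<lambda>r. eigval c (\<nu> r)"] eigval_mem_Icc) auto
    ultimately show "\<delta> < eigval c (\<nu> r)" by simp
  qed
qed (intro finite_PiE finite_eigval_greater assms finite_lessThan)

theorem theorem1p5:
  fixes d :: nat and q \<delta> \<delta>' c :: real
  assumes "d \<ge> 1"
    and "1/2 < q" and "q < 1"
    and "0 < \<delta>" and "\<delta> < 1/2"
    and "\<delta>' = \<delta> / q ^ (d - 1)"
    and "\<delta>' < 1/2"
    and "c > 0"
  shows "Lambda_count \<delta> c d \<ge> d * N_count q c ^ (d - 1) * D_count \<delta>' c"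
proof -
  define A where "A = {n. q < eigval c n}"
  define D where "D = {n. \<delta>' < eigval c n \<and> eigval c n \<le> 1/2}"
  \<comment> \<open>In \<open>P i\<close> the exceptional component is \<open>i\<close>.\<close>
  define P where "P i = PiE {..<d} (\<lambda>r. if r = i then D else A)" for i
  define L where "L = {\<nu> \<in> {..<d} \<rightarrow>\<^sub>E (UNIV :: nat set). \<delta> < mu c d \<nu> \<and> mu c d \<nu> \<le> 1 - \<delta>}"
  have "\<delta>' > 0" using assms by simp
  have finA: "finite A"
    unfolding A_def using assms by (intro finite_eigval_greater) auto
  have finD: "finite D"
    by (rule finite_subset[OF _ finite_eigval_greater[OF \<open>\<delta>' > 0\<close> \<open>c > 0\<close>]]) (auto simp: D_def)
  have finP: "finite (P i)" for i
    unfolding P_def using finA finD by (intro finite_PiE) auto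
  \<comment> \<open>The final comparison rests on this, since \<open>card\<close> of an infinite set
    is 0.\<close>
  have finL: "finite L"
    by (rule finite_subset[OF _ finite_mu_greater[OF \<open>0 < \<delta>\<close> \<open>c > 0\<close>, of d]]) (auto simp: L_def)
  have cardP: "card (P i) = card A ^ (d - 1) * card D" if "i < d" for i
  proof -
    have "card (P i) = (\<Prod>r<d. card (if r = i then D else A))"
      unfolding P_def by (rule card_PiE) simp
    also have "\<dots> = card D * (\<Prod>r\<in>{..<d} - {i}. card (if r = i then D else A))"
      using that by (subst prod.remove[of _ i]) auto
    also have "(\<Prod>r\<in>{..<d} - {i}. card (if r = i then D else A)) = (\<Prod>r\<in>{..<d} - {i}. card A)"
      by (intro prod.cong) auto
    finally show ?thesis using that by simp
  qed
  have memP: "\<nu> r \<in> (if r = i then D else A)" if "\<nu> \<in> P i" "r < d" for \<nu> i r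
    using PiE_mem[OF that(1)[unfolded P_def], of r] that(2) by simp
  \<comment> \<open>For a common member, component \<open>i\<close> would lie in both
    \<open>D\<close> and \<open>A\<close>, whose eigenvalues are on different sides of
    \<open>1/2\<close>.\<close>
  have disj: "P i \<inter> P j = {}" if "i < d" "j < d" "i \<noteq> j" for i j
  proof -
    have "A \<inter> D = {}" using \<open>1/2 < q\<close> by (auto simp: A_def D_def)
    moreover have "\<nu> i \<in> D" "\<nu> i \<in> A" if "\<nu> \<in> P i \<inter> P j" for \<nu>
      using memP[of \<nu> i i] memP[of \<nu> j i] that \<open>i < d\<close> \<open>i \<noteq> j\<close> by auto
    ultimately show ?thesis by blast
  qed
  have sub: "P i \<subseteq> L" if "i < d" for i
  proof
    fix \<nu> assume \<nu>: "\<nu> \<in> P i"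
    have \<nu>i: "\<nu> i \<in> D" and \<nu>r: "\<And>r. r < d \<Longrightarrow> r \<noteq> i \<Longrightarrow> \<nu> r \<in> A"
      using memP[OF \<nu>] \<open>i < d\<close> by (metis, metis)
    have "\<delta> = \<delta>' * q ^ (d - 1)"
      using assms by simp
    \<comment> \<open>Strictness comes from component \<open>i\<close> alone, which covers
      \<open>d = 1\<close>, where there are no others.\<close>
    also have "\<dots> < eigval c (\<nu> i) * q ^ (d - 1)"
      using \<nu>i \<open>1/2 < q\<close> by (intro mult_strict_right_mono) (auto simp: D_def)
    also have "q ^ (d - 1) = (\<Prod>r\<in>{..<d} - {i}. q)"
      using that by simp
    also have "eigval c (\<nu> i) * \<dots> \<le> eigval c (\<nu> i) * (\<Prod>r\<in>{..<d} - {i}. eigval c (\<nu> r))"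
      using \<nu>r eigval_mem_Icc[of c] \<open>1/2 < q\<close>
      by (intro mult_left_mono prod_mono) (auto simp: A_def less_imp_le)
    also have "\<dots> = mu c d \<nu>"
      unfolding mu_def using that by (intro prod.remove[symmetric]) auto
    finally have "\<delta> < mu c d \<nu>" .
    \<comment> \<open>The other factors are at most 1, so the product inherits the bound
      \<open>1/2\<close>, which is below \<open>1 - \<delta>\<close>.\<close>
    moreover have "mu c d \<nu> \<le> eigval c (\<nu> i)"
      unfolding mu_def using that by (intro prod_le_factor[of _ i "\<lambda>r. eigval c (\<nu> r)"] eigval_mem_Icc) auto
    then have "mu c d \<nu> \<le> 1 - \<delta>"
      using \<nu>i \<open>\<delta> < 1/2\<close> by (auto simp: D_def)
    ultimately show "\<nu> \<in> L"
      using \<nu> by (auto simp: L_def P_def PiE_iff)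
  qed
  have "d * N_count q c ^ (d - 1) * D_count \<delta>' c = (\<Sum>i<d. card (P i))"
    by (simp add: cardP N_count_def D_count_def A_def D_def)
  also have "\<dots> = card (\<Union>i<d. P i)"
    using finP disj by (intro card_UN_disjoint[symmetric]) auto
  also have "\<dots> \<le> card L"
    using sub by (intro card_mono finL) auto
  finally show ?thesis
    by (simp add: Lambda_count_def L_def)
qed

end
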